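(* Let $n,s,t,\delta$ be integers with $s\ge 2$ and $4\le 2t\le \delta\le \left\lfloor \frac{n+t-1}{2}\right\rfloor$, and let $h=\left\lfloor \frac{n+t-1}{2}\right\rfloor$. Put $$f_0(n,t,\delta,s)=\binom{n+t-\delta}{s}+(\delta-t)\binom{\delta}{s-1},$$ $$g_0(n,t,\delta,s)=\binom{n+t-h}{s}+(h-t-1)\binom{h}{s-1}+\binom{\delta}{s-1}.$$ Let $G$ be a finite, simple, connected graph of order $n$ with minimum degree $\delta$. If $$N_s(G)>\max\{f_0(n,t,\delta,s),\,g_0(n,t,\delta,s)\},$$ then $G$ is many-to-many $t$-disjoint path coverable.
   Context: The order of a graph is its number of vertices. $N_s(G)$ is the number of $s$-cliques of $G$, i.e. of sets of exactly $s$ vertices of $G$ that are pairwise adjacent. A graph $G$ is many-to-many $t$-disjoint path coverable if for any two disjoint vertex subsets $U=\{u_1,\dots,u_t\}$ and $V=\{v_1,\dots,v_t\}$ of $G$, each consisting of $t$ distinct vertices, there exist a permutation $\tau$ of $\{1,\dots,t\}$ and $t$ paths $P_1,\dots,P_t$ in $G$ such that $P_i$ joins $u_i$ and $v_{\tau(i)}$ and every vertex of $G$ belongs to exactly one of the paths. Binomial coefficients $\binom{a}{b}$ with integers $0\le a<b$ are $0$. *)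

theory Defs
  imports "Graph_Theory.Graph_Theory" "HOL-Combinatorics.Permutations"
begin

text \<open>
  Finite simple graphs are rendered by the locale \<^const>\<open>graph\<close>: finite, loop-free digraphs
  without parallel arcs whose arc relation is symmetric. Each undirected edge is thus a pair of
  opposite arcs, and the degree of a vertex is its out-degree.
\<close>

definition min_degree :: "('a, 'b) pre_digraph \<Rightarrow> nat" where
  "min_degree G = Min (out_degree G ` verts G)"

definition cliques :: "('a, 'b) pre_digraph \<Rightarrow> nat \<Rightarrow> 'a set set" where
  "cliques G s =
    {K. K \<subseteq> verts G \<and> card K = s \<and> (\<forall>x\<in>K. \<forall>y\<in>K. x \<noteq> y \<longrightarrow> x \<rightarrow>\<^bsub>G\<^esub> y)}"

definition num_cliques :: "nat \<Rightarrow> ('a, 'b) pre_digraph \<Rightarrow> nat" where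
  "num_cliques s G = card (cliques G s)"

text \<open>A path is given by the list of its vertices.\<close>

definition joins :: "('a, 'b) pre_digraph \<Rightarrow> 'a list \<Rightarrow> 'a \<Rightarrow> 'a \<Rightarrow> bool" where
  "joins G p x y \<longleftrightarrow> vpath p G \<and> hd p = x \<and> last p = y"

definition disjoint_path_coverable :: "nat \<Rightarrow> ('a, 'b) pre_digraph \<Rightarrow> bool" where
  "disjoint_path_coverable t G \<longleftrightarrow>
    (\<forall>u v :: nat \<Rightarrow> 'a.
      inj_on u {1..t} \<and> inj_on v {1..t} \<and>
      u ` {1..t} \<subseteq> verts G \<and> v ` {1..t} \<subseteq> verts G \<and>
      u ` {1..t} \<inter> v ` {1..t} = {} \<longrightarrow>
      (\<exists>\<tau> P.
        \<tau> permutes {1..t} \<and>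
        (\<forall>i\<in>{1..t}. joins G (P i) (u i) (v (\<tau> i))) \<and>
        (\<forall>x\<in>verts G. \<exists>!i. i \<in> {1..t} \<and> x \<in> set (P i))))"

text \<open>
  The subtractions below are on natural numbers. None of them truncates in the range of interest
  \<open>2 \<le> s\<close>, \<open>4 \<le> 2 * t\<close>, \<open>2 * t \<le> \<delta>\<close>, \<open>\<delta> \<le> (n + t - 1) div 2\<close>.
\<close>

definition f0 :: "nat \<Rightarrow> nat \<Rightarrow> nat \<Rightarrow> nat \<Rightarrow> nat" where
  "f0 n t \<delta> s = ((n + t - \<delta>) choose s) + (\<delta> - t) * (\<delta> choose (s - 1))"

definition g0 :: "nat \<Rightarrow> nat \<Rightarrow> nat \<Rightarrow> nat \<Rightarrow> nat" where
  "g0 n t \<delta> s =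
    (let h = (n + t - 1) div 2
     in ((n + t - h) choose s) + (h - t - 1) * (h choose (s - 1)) + (\<delta> choose (s - 1)))"

end

theory Submission
  imports Defs "HOL-Library.Multiset"
begin

text \<open>
  A graph that is not coverable can be enlarged, by adding edges, to a maximal graph that has no
  linkage between some fixed \<open>U\<close> and \<open>V\<close>. Rerouting the linkage obtained from one more edge
  \<open>xy\<close> shows, as in Ore's theorem, that nonadjacent \<open>x\<close> and \<open>y\<close> satisfy
  \<open>d(x) + d(y) \<le> n + t - 1\<close>. Choose such a pair with maximal degree sum and \<open>k = d(x) \<le> d(y)\<close>:
  the at least \<open>k - t\<close> non-neighbours of \<open>y\<close> all have degree at most \<open>k\<close>, and
  \<open>\<delta> \<le> k \<le> h\<close>. Counting the cliques that meet \<open>k - t\<close> vertices of degree at most \<open>k\<close>, one of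
  them of degree \<open>\<delta>\<close>, bounds \<open>N\<^sub>s(G)\<close> by a function of \<open>k\<close> that is convex on \<open>[\<delta>, h]\<close> and
  equals \<open>f\<^sub>0\<close> and \<open>g\<^sub>0\<close> at the two ends.
\<close>

section \<open>Linkages and rerouting in the manner of Ore\<close>

text \<open>A multiset of paths leaves the pairing of the ends free, so rerouting may change it. For
  finite \<open>W\<close>, the equation with \<open>mset_set W\<close> says at once that the paths
  have no repeated vertex, are disjoint and cover \<open>W\<close>.\<close>

definition linkage ::
    "'a rel \<Rightarrow> 'a set \<Rightarrow> 'a set \<Rightarrow> 'a set \<Rightarrow> 'a list multiset \<Rightarrow> bool" where
  "linkage E W U T M \<longleftrightarrow>
    (\<forall>p\<in>#M. p \<noteq> [] \<and> successively (\<lambda>a b. (a, b) \<in> E) p) \<and>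
    (\<Sum>p\<in>#M. mset p) = mset_set W \<and>
    image_mset hd M = mset_set U \<and>
    image_mset last M = mset_set T"

lemma not_successively_split:
  assumes "\<not> successively P p"
  obtains a c d b where "p = a @ c # d # b" "\<not> P c d"
proof -
  have "\<exists>a c d b. p = a @ c # d # b \<and> \<not> P c d"
    using assms
  proof (induction P p rule: successively.induct)
    case (3 P x y xs)
    show ?case
    proof (cases "P x y")
      case True
      with 3 obtain a c d b where "y # xs = a @ c # d # b" "\<not> P c d" by auto
      then have "x # y # xs = (x # a) @ c # d # b \<and> \<not> P c d" by simp
      then show ?thesis by blast
    next
      case False
      then have "x # y # xs = [] @ x # y # xs \<and> \<not> P x y" by simp
      then show ?thesis by blast
    qed
  qed auto
  then show thesis using that by blast
qed

text \<open>Shift every \<open>X\<close>-position except the last by one: the results avoid all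
  \<open>Y\<close>-positions, and together with the \<open>Y\<close>-positions other than the first
  they fit into \<open>length p - 1\<close> places.\<close>

lemma filter_length_bound_no_crossing:
  assumes "p \<noteq> []" and "successively (\<lambda>c d. \<not> (X c \<and> Y d)) p"
  shows "length (filter X p) + length (filter Y p) + 1
    \<le> length p + of_bool (X (last p)) + of_bool (Y (hd p))"
  using assms
proof (induction p rule: induct_list012)
  case (3 c d p)
  then have "\<not> (X c \<and> Y d)" by simp
  with 3 show ?case by (auto split: if_splits)
qed auto

lemma card_image_rel_eq_filter:
  assumes "finite W" "E \<subseteq> W \<times> W"
  shows "card (E `` {x}) = size (filter_mset (\<lambda>w. (x, w) \<in> E) (mset_set W))"
proof -
  have "E `` {x} = {w \<in> W. (x, w) \<in> E}" using assms(2) by auto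
  then show ?thesis using assms(1) by simp
qed

lemma size_filter_sum_mset:
  "size (filter_mset P (\<Sum>p\<in>#M. mset p)) = (\<Sum>p\<in>#M. length (filter P p))"
  by (induction M) (auto simp flip: mset_filter)

text \<open>\<open>A\<close> and \<open>B\<close> are the halves of a path cut at the missing edge
  \<open>xy\<close>. Since no rerouting gives a linkage, neighbours of \<open>x\<close> and
  \<open>y\<close> cannot cross on any path. \<open>A\<close> and \<open>B\<close> each add at most
  their length to the degree sum, every other path at most one more than its length, whence
  \<open>size M\<close>.\<close>

lemma crossing_bound:
  assumes "finite W" "E \<subseteq> W \<times> W" "sym E" "(x, x) \<notin> E" "(y, y) \<notin> E"
    and A: "A \<noteq> []" "last A = x" "successively (\<lambda>a b. (a, b) \<in> E) A"
    and B: "B \<noteq> []" "hd B = y" "successively (\<lambda>a b. (a, b) \<in> E) B"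
    and M: "\<And>p. p \<in># M \<Longrightarrow> p \<noteq> [] \<and> successively (\<lambda>a b. (a, b) \<in> E) p"
    and W: "mset A + mset B + (\<Sum>p\<in>#M. mset p) = mset_set W"
    and U: "add_mset (hd A) (image_mset hd M) = mset_set U"
    and T: "add_mset (last B) (image_mset last M) = mset_set T"
    and none: "\<And>N. \<not> linkage E W U T N"
  shows "card (E `` {x}) + card (E `` {y}) \<le> card W + size M"
proof -
  let ?s = "successively (\<lambda>a b. (a, b) \<in> E)"
  let ?X = "\<lambda>w. (x, w) \<in> E" and ?Y = "\<lambda>w. (y, w) \<in> E"
  have symE: "(a, b) \<in> E \<Longrightarrow> (b, a) \<in> E" for a b using assms(3) by (rule symD)
  have converse: "successively (\<lambda>a b. (b, a) \<in> E) p" if "?s p" for p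
    using that by (rule successively_mono) (rule symE)
  \<comment> \<open>For consecutive \<open>c, d\<close> on \<open>A\<close>, the edges \<open>xc\<close> and \<open>yd\<close> would join \<open>A\<close> and \<open>B\<close> into
    the path \<open>..c x..d y..\<close>; the same happens on \<open>B\<close> with \<open>..x c..y d..\<close>.\<close>
  have "successively (\<lambda>c d. \<not> (?X c \<and> ?Y d)) A"
  proof (rule ccontr)
    assume "\<not> ?thesis"
    then obtain a c d b where s: "A = a @ c # d # b" "?X c" "?Y d"
      by (elim not_successively_split) blast
    have "linkage E W U T (add_mset ((a @ [c]) @ rev (d # b) @ B) M)"
      unfolding linkage_def
    proof (intro conjI ballI)
      fix p assume p: "p \<in># add_mset ((a @ [c]) @ rev (d # b) @ B) M"
      then show "p \<noteq> []" using M by auto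
      have "?s (a @ [c])" "?s (d # b)" "last (d # b) = x"
        using A s by (auto simp: successively_append_iff successively_Cons)
      moreover from this have "?s (rev (d # b))"
        using converse by (simp only: successively_rev)
      ultimately have "?s ((a @ [c]) @ rev (d # b) @ B)"
        using B s symE unfolding successively_append_iff
        by (auto simp: hd_rev last_rev hd_append simp del: rev.simps)
      then show "?s p" using p M by auto
    qed (use s W U T B in \<open>auto simp: hd_append ac_simps\<close>)
    then show False using none by blast
  qed
  \<comment> \<open>The last vertex of \<open>A\<close> is \<open>x\<close>, not its own neighbour,
    so only the end term for \<open>hd A\<close> can survive; on \<open>B\<close> it is the one for
    \<open>last B\<close>.\<close>
  then have bA: "length (filter ?X A) + length (filter ?Y A) \<le> length A"
    using filter_length_bound_no_crossing[of A ?X ?Y] A assms(4) by (auto simp: of_bool_def split: if_splits)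
  have "successively (\<lambda>c d. \<not> (?X c \<and> ?Y d)) B"
  proof (rule ccontr)
    assume "\<not> ?thesis"
    then obtain a c d b where s: "B = a @ c # d # b" "?X c" "?Y d"
      by (elim not_successively_split) blast
    have "linkage E W U T (add_mset (A @ rev (a @ [c]) @ d # b) M)"
      unfolding linkage_def
    proof (intro conjI ballI)
      fix p assume p: "p \<in># add_mset (A @ rev (a @ [c]) @ d # b) M"
      then show "p \<noteq> []" using M by auto
      have "?s (a @ [c])" "?s (d # b)" "hd (a @ [c]) = y"
        using B s by (auto simp: successively_append_iff successively_Cons hd_append)
      moreover from this have "?s (rev (a @ [c]))"
        using converse by (simp only: successively_rev)
      ultimately have "?s (A @ rev (a @ [c]) @ d # b)"
        using A s symE unfolding successively_append_iff
        by (auto simp: hd_rev last_rev hd_append simp del: rev.simps rev_append)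
      then show "?s p" using p M by auto
    qed (use s W U T A in \<open>auto simp: hd_append ac_simps\<close>)
    then show False using none by blast
  qed
  then have bB: "length (filter ?X B) + length (filter ?Y B) \<le> length B"
    using filter_length_bound_no_crossing[of B ?X ?Y] B assms(5) by (auto simp: of_bool_def split: if_splits)
  have bM: "length (filter ?Y q) + length (filter ?X q) \<le> length q + 1" if q: "q \<in># M" for q
  proof -
    \<comment> \<open>On a third path \<open>X\<close> and \<open>Y\<close> change roles: there \<open>A\<close> and \<open>B\<close> exchange tails with it,
      which alters the pairing of the ends but not the two sets of ends.\<close>
    have "successively (\<lambda>c d. \<not> (?Y c \<and> ?X d)) q"
    proof (rule ccontr)
      assume "\<not> ?thesis"
      then obtain a c d b where s: "q = a @ c # d # b" "?Y c" "?X d"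
        by (elim not_successively_split) blast
      from q obtain M' where M': "M = add_mset q M'" by (metis multi_member_split)
      let ?N = "add_mset (A @ d # b) (add_mset ((a @ [c]) @ B) M')"
      have "linkage E W U T ?N"
        unfolding linkage_def
      proof (intro conjI ballI)
        fix p assume p: "p \<in># ?N"
        then show "p \<noteq> []" using M M' by auto
        have "?s (a @ [c])" "?s (d # b)"
          using M[OF q] s by (auto simp: successively_append_iff successively_Cons)
        then have "?s (A @ d # b)" "?s ((a @ [c]) @ B)"
          using A B s symE unfolding successively_append_iff by auto
        then show "?s p" using p M M' by auto
      qed (use s W U T A B M' in \<open>auto simp: hd_append ac_simps add_mset_commute\<close>)
      then show False using none by blast
    qed
    then show ?thesis
      using filter_length_bound_no_crossing[of q ?Y ?X] M[OF q] by (auto simp: of_bool_def split: if_splits)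
  qed
  have deg: "card (E `` {z}) = length (filter (\<lambda>w. (z, w) \<in> E) A) +
      length (filter (\<lambda>w. (z, w) \<in> E) B) + (\<Sum>q\<in>#M. length (filter (\<lambda>w. (z, w) \<in> E) q))" for z
    unfolding card_image_rel_eq_filter[OF assms(1,2)] W[symmetric]
    by (simp add: size_filter_sum_mset flip: mset_filter)
  have "size (mset_set W) = length A + length B + (\<Sum>q\<in>#M. length q)"
    unfolding W[symmetric] using size_filter_sum_mset[of "\<lambda>_. True" M] by simp
  then have cW: "card W = length A + length B + (\<Sum>q\<in>#M. length q)" by simp
  have "(\<Sum>q\<in>#M. length (filter ?Y q) + length (filter ?X q)) \<le> (\<Sum>q\<in>#M. length q + 1)"
    using bM by (rule sum_mset_mono)
  also have "\<dots> = (\<Sum>q\<in>#M. length q) + size M" by (induction M) auto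
  finally show ?thesis
    using bA bB unfolding deg cW by (simp add: sum_mset.distrib)
qed

text \<open>Some path must use the new edge; cutting it there leaves \<open>card U - 1\<close> other
  paths, which makes the inequality strict.\<close>

lemma linkage_insert_edge:
  assumes "finite W" "E \<subseteq> W \<times> W" "sym E" "irrefl E" "(x, y) \<notin> E"
    and L: "linkage (insert (x, y) (insert (y, x) E)) W U T M"
    and none: "\<And>N. \<not> linkage E W U T N"
  shows "card (E `` {x}) + card (E `` {y}) < card W + card U"
proof -
  let ?F = "insert (x, y) (insert (y, x) E)"
  have yx: "(y, x) \<notin> E" using assms(3,5) by (meson symD)
  have "\<exists>p\<in>#M. \<not> successively (\<lambda>a b. (a, b) \<in> E) p"
    using L none[of M] unfolding linkage_def by blast
  then obtain p where p: "p \<in># M" "\<not> successively (\<lambda>a b. (a, b) \<in> E) p" by blast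
  from p(2) obtain a c d b where s: "p = a @ c # d # b" "(c, d) \<notin> E"
    by (elim not_successively_split)
  from p(1) obtain M' where M': "M = add_mset p M'" by (metis multi_member_split)
  have W: "mset a + mset b + (\<Sum>p\<in>#M'. mset p) + {#c, d#} = mset_set W"
    using L unfolding linkage_def M' s(1) by (simp add: ac_simps)
  have cnt: "count (mset_set W) z \<le> 1" for z by (simp add: count_mset_set')
  \<comment> \<open>Each of \<open>c\<close> and \<open>d\<close> is covered only once, so the new
    edge is used just once and everything else already runs in \<open>E\<close>.\<close>
  have dist: "c \<noteq> d" "c \<notin> set a" "c \<notin> set b" "d \<notin> set a" "d \<notin> set b"
    and distM: "\<And>q. q \<in># M' \<Longrightarrow> c \<notin> set q \<and> d \<notin> set q"
  proof -
    let ?R = "\<Sum>p\<in>#M'. mset p"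
    have c: "count (mset a) c + count (mset b) c + count ?R c + (if c = d then 2 else 1) \<le> 1"
      using cnt[of c] unfolding W[symmetric] by auto
    have d: "count (mset a) d + count (mset b) d + count ?R d + (if c = d then 2 else 1) \<le> 1"
      using cnt[of d] unfolding W[symmetric] by auto
    show "c \<noteq> d" "c \<notin> set a" "c \<notin> set b" "d \<notin> set a" "d \<notin> set b"
      using c d by (auto split: if_splits simp: count_list_0_iff)
    fix q assume "q \<in># M'"
    moreover have "count ?R c = 0" "count ?R d = 0" using c d by (auto split: if_splits)
    then have "c \<notin># ?R" "d \<notin># ?R" by (simp_all only: not_in_iff)
    ultimately show "c \<notin> set q \<and> d \<notin> set q" by auto
  qed
  have sF: "successively (\<lambda>a b. (a, b) \<in> ?F) p" using L p(1) unfolding linkage_def by blast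
  then have "(c, d) \<in> ?F" unfolding s(1) by (simp add: successively_append_iff)
  with s(2) have cd: "c = x \<and> d = y \<or> c = y \<and> d = x" by auto
  have old: "successively (\<lambda>a b. (a, b) \<in> E) q"
    if "successively (\<lambda>a b. (a, b) \<in> ?F) q" "c \<notin> set q \<or> d \<notin> set q" for q
    using that(1) by (rule successively_mono) (use that(2) cd in auto)
  \<comment> \<open>The path may traverse the new edge in either direction; the degree sum is
    symmetric, so bounding it for \<open>c\<close> and \<open>d\<close> suffices.\<close>
  have "card (E `` {c}) + card (E `` {d}) \<le> card W + size M'"
  proof (rule crossing_bound[where A = "a @ [c]" and B = "d # b", OF assms(1-3)])
    show "(c, c) \<notin> E" "(d, d) \<notin> E" using assms(4) by (auto simp: irrefl_def)
    have "successively (\<lambda>a b. (a, b) \<in> ?F) ((a @ [c]) @ (d # b))" using sF s(1) by simp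
    then have "successively (\<lambda>a b. (a, b) \<in> ?F) (a @ [c])"
      "successively (\<lambda>a b. (a, b) \<in> ?F) (d # b)"
      unfolding successively_append_iff by blast+
    then show "successively (\<lambda>a b. (a, b) \<in> E) (a @ [c])"
      "successively (\<lambda>a b. (a, b) \<in> E) (d # b)"
      using dist by (auto intro!: old)
    fix q assume q: "q \<in># M'"
    then show "q \<noteq> [] \<and> successively (\<lambda>a b. (a, b) \<in> E) q"
      using L distM[OF q] unfolding linkage_def M' by (auto intro!: old)
  next
    show "mset (a @ [c]) + mset (d # b) + (\<Sum>p\<in>#M'. mset p) = mset_set W"
      using W by (simp add: ac_simps add_mset_commute)
    show "add_mset (hd (a @ [c])) (image_mset hd M') = mset_set U"
      using L unfolding linkage_def M' s(1) by (auto simp: hd_append split: if_splits)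
    show "add_mset (last (d # b)) (image_mset last M') = mset_set T"
      using L unfolding linkage_def M' s(1) by simp
  qed (use none in auto)
  moreover have "size M' < card U"
  proof -
    have "size (image_mset hd M) = card U" using L unfolding linkage_def by simp
    then show ?thesis unfolding M' by simp
  qed
  moreover have "card (E `` {c}) + card (E `` {d}) = card (E `` {x}) + card (E `` {y})"
    using cd by auto
  ultimately show ?thesis by linarith
qed


section \<open>Saturation and vertices of low degree\<close>

text \<open>One path absorbs all vertices outside \<open>U\<close> and \<open>T\<close>; the
  remaining ends are matched by single edges. Hence a saturated graph without a linkage still has a
  nonadjacent pair.\<close>

lemma complete_linkage:
  assumes "finite W" "U \<subseteq> W" "T \<subseteq> W" "U \<inter> T = {}" "card U = card T" "U \<noteq> {}"
  shows "\<exists>M. linkage (W \<times> W - Id) W U T M"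
proof -
  have fin: "finite U" "finite T" "finite (W - U - T)"
    using assms by (auto intro: finite_subset)
  obtain us where us: "set us = U" "distinct us" using fin(1) finite_distinct_list by blast
  obtain ts where ts: "set ts = T" "distinct ts" using fin(2) finite_distinct_list by blast
  obtain r where r: "set r = W - U - T" "distinct r" using fin(3) finite_distinct_list by blast
  have "length us = length ts" using us ts assms(5) distinct_card by metis
  obtain u us' where us': "us = u # us'" using us(1) assms(6) by (cases us) auto
  with \<open>length us = length ts\<close> obtain t ts' where ts': "ts = t # ts'" by (cases ts) auto
  have len: "length us' = length ts'" using \<open>length us = length ts\<close> us' ts' by simp
  let ?Q = "mset (map2 (\<lambda>a b. [a, b]) us' ts')"
  have Q: "(\<Sum>q\<in>#?Q. mset q) = mset us' + mset ts'"
    "image_mset hd ?Q = mset us'" "image_mset last ?Q = mset ts'"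
    using len by (induction us' ts' rule: list_induct2) auto
  have dW: "distinct (us @ ts @ r)" "set (us @ ts @ r) = W"
    using us ts r assms(2-4) by auto
  then have W: "mset_set W = mset us + mset ts + mset r"
    using mset_set_set[of "us @ ts @ r"] by (simp add: ac_simps)
  have U: "mset_set U = mset us" and T: "mset_set T = mset ts"
    using us ts mset_set_set by blast+
  have path: "successively (\<lambda>a b. (a, b) \<in> W \<times> W - Id) p"
    if "distinct p" "set p \<subseteq> W" for p
    using that by (induction p rule: induct_list012) auto
  have "linkage (W \<times> W - Id) W U T (add_mset (u # r @ [t]) ?Q)"
    unfolding linkage_def
  proof (intro conjI ballI)
    fix p assume "p \<in># add_mset (u # r @ [t]) ?Q"
    then consider "p = u # r @ [t]" | a b where "p = [a, b]" "a \<in> set us'" "b \<in> set ts'"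
      by (auto dest: set_zip_leftD set_zip_rightD)
    then have "p \<noteq> [] \<and> distinct p \<and> set p \<subseteq> W"
      using dW us' ts' by cases auto
    then show "p \<noteq> []" "successively (\<lambda>a b. (a, b) \<in> W \<times> W - Id) p"
      using path by blast+
  qed (use Q W U T us' ts' in \<open>auto simp: ac_simps\<close>)
  then show ?thesis by blast
qed

text \<open>\<open>k\<close> is a degree in a saturated supergraph of \<open>E\<close>. Degrees in
  \<open>E\<close> are no larger, so the upper bounds on degrees pass down to \<open>E\<close>,
  although \<open>x\<close> need not have degree exactly \<open>k\<close> there.\<close>

lemma nonlinkable_low_degrees:
  assumes "finite W" "E \<subseteq> W \<times> W" "sym E" "irrefl E"
    and UT: "U \<subseteq> W" "T \<subseteq> W" "U \<inter> T = {}" "card U = card T" "U \<noteq> {}"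
    and none: "\<And>N. \<not> linkage E W U T N"
  obtains k x where "x \<in> W" "card (E `` {x}) \<le> k" "2 * k < card W + card U"
    "k \<le> card {w \<in> W. card (E `` {w}) \<le> k} + card U"
proof -
  define \<F> where "\<F> = {F. E \<subseteq> F \<and> F \<subseteq> W \<times> W - Id \<and> sym F \<and> (\<forall>N. \<not> linkage F W U T N)}"
  have "\<F> \<subseteq> Pow (W \<times> W)" unfolding \<F>_def by auto
  then have "finite \<F>" using assms(1) by (meson finite_Pow_iff finite_SigmaI finite_subset)
  moreover have "E \<in> \<F>" using assms unfolding \<F>_def by (auto simp: irrefl_def)
  ultimately obtain F where "F \<in> \<F>" and max: "\<And>H. H \<in> \<F> \<Longrightarrow> F \<subseteq> H \<Longrightarrow> F = H"
    using finite_has_maximal2 by metis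
  then have F: "E \<subseteq> F" "F \<subseteq> W \<times> W - Id" "sym F" "\<And>N. \<not> linkage F W U T N"
    unfolding \<F>_def by auto
  define d where "d v = card (F `` {v})" for v
  have FW: "F \<subseteq> W \<times> W" and "irrefl F" using F(2) by (auto simp: irrefl_def)
  have symF: "(a, b) \<in> F \<longleftrightarrow> (b, a) \<in> F" for a b using F(3) by (meson symD)
  have dE: "card (E `` {v}) \<le> d v" for v
    unfolding d_def by (rule card_mono) (use FW assms(1) F(1) in \<open>auto intro: finite_subset[of _ W]\<close>)
  let ?P = "{(x, y). x \<in> W \<and> y \<in> W \<and> x \<noteq> y \<and> (x, y) \<notin> F}"
  let ?f = "\<lambda>(x, y). d x + d y"
  have finP: "finite ?P" by (rule finite_subset[of _ "W \<times> W"]) (use assms(1) in auto)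
  have "?P \<noteq> {}"
  proof
    assume "?P = {}"
    then have "F = W \<times> W - Id" using F(2) by auto
    then show False using complete_linkage[OF assms(1) UT] F(4) by blast
  qed
  then have "Max (?f ` ?P) \<in> ?f ` ?P" using finP by (intro Max_in) auto
  then obtain x0 y0 where 0: "(x0, y0) \<in> ?P" "Max (?f ` ?P) = d x0 + d y0" by auto
  obtain x y where xy: "(x, y) \<in> ?P" "d x + d y = d x0 + d y0" "d x \<le> d y"
  proof (cases "d x0 \<le> d y0")
    case True
    then show ?thesis using that 0 by blast
  next
    case False
    then show ?thesis using that[of y0 x0] 0 symF by auto
  qed
  \<comment> \<open>Maximality of the degree sum, with \<open>y\<close> held fixed, forces every
    other non-neighbour of \<open>y\<close> to have degree at most \<open>d x\<close>.\<close>
  have best: "d w + d y \<le> d x + d y" if "w \<in> W" "w \<noteq> y" "(w, y) \<notin> F" for w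
  proof -
    have "?f (w, y) \<le> Max (?f ` ?P)"
      by (rule Max_ge) (use that xy finP in auto)
    then show ?thesis using 0 xy by simp
  qed
  let ?F' = "insert (x, y) (insert (y, x) F)"
  have "?F' \<notin> \<F>" using max[of ?F'] xy by blast
  then obtain M where "linkage ?F' W U T M"
    using F(1-3) xy unfolding \<F>_def by (auto simp: sym_def)
  from linkage_insert_edge[OF assms(1) FW F(3) \<open>irrefl F\<close> _ this F(4)] xy
  have sum: "d x + d y < card W + card U" by (auto simp: d_def)
  \<comment> \<open>The strictness in \<open>sum\<close> makes up for leaving \<open>y\<close>
    itself out of its non-neighbours.\<close>
  let ?Z = "W - insert y (F `` {y})"
  have "insert y (F `` {y}) \<subseteq> W" using FW xy by auto
  moreover have "finite (F `` {y})" by (rule finite_subset[of _ W]) (use FW assms(1) in auto)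
  moreover have "y \<notin> F `` {y}" using \<open>irrefl F\<close> by (auto simp: irrefl_def)
  ultimately have "card ?Z = card W - (d y + 1)" "d y + 1 \<le> card W"
    using card_Diff_subset[of "insert y (F `` {y})" W] card_mono[OF assms(1), of "insert y (F `` {y})"]
    by (simp_all add: d_def)
  then have "d x \<le> card ?Z + card U" using sum by linarith
  moreover have "?Z \<subseteq> {w \<in> W. card (E `` {w}) \<le> d x}"
  proof
    fix w assume w: "w \<in> ?Z"
    then have "d w \<le> d x" using best[of w] symF[of w y] by auto
    then show "w \<in> {w \<in> W. card (E `` {w}) \<le> d x}" using w dE[of w] by auto
  qed
  then have "card ?Z \<le> card {w \<in> W. card (E `` {w}) \<le> d x}"
    using assms(1) by (intro card_mono) auto
  ultimately have "d x \<le> card {w \<in> W. card (E `` {w}) \<le> d x} + card U" by linarith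
  with that[of x "d x"] show thesis using xy sum dE[of x] by auto
qed

section \<open>Counting cliques through low-degree vertices\<close>

text \<open>A clique avoids \<open>S\<close>, or it is some \<open>v\<close> in \<open>S\<close>
  together with \<open>s - 1\<close> neighbours of \<open>v\<close>. Cliques meeting
  \<open>S\<close> more than once are overcounted, which is harmless.\<close>

lemma card_cliques_le:
  assumes "finite W" "E \<subseteq> W \<times> W" "S \<subseteq> W" "s \<ge> 1"
  shows "card {K. K \<subseteq> W \<and> card K = s \<and> (\<forall>x\<in>K. \<forall>y\<in>K. x \<noteq> y \<longrightarrow> (x, y) \<in> E)}
    \<le> ((card W - card S) choose s) + (\<Sum>v\<in>S. card (E `` {v}) choose (s - 1))"
proof -
  let ?\<K> = "{K. K \<subseteq> W \<and> card K = s \<and> (\<forall>x\<in>K. \<forall>y\<in>K. x \<noteq> y \<longrightarrow> (x, y) \<in> E)}"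
  let ?\<A> = "{K. K \<subseteq> W - S \<and> card K = s}"
  let ?\<B> = "\<lambda>v. {J. J \<subseteq> E `` {v} \<and> card J = s - 1}"
  have finS: "finite S" using assms finite_subset by blast
  have finE: "finite (E `` {v})" for v using assms(1,2) by (auto intro: finite_subset[of _ W])
  have fin: "finite ?\<A>" "finite (?\<B> v)" for v
    using finite_subset[of ?\<A> "Pow W"] finite_subset[of "?\<B> v" "Pow (E `` {v})"] assms(1) finE
    by auto
  have "?\<K> \<subseteq> ?\<A> \<union> (\<Union>v\<in>S. insert v ` ?\<B> v)"
  proof
    fix K assume K: "K \<in> ?\<K>"
    show "K \<in> ?\<A> \<union> (\<Union>v\<in>S. insert v ` ?\<B> v)"
    proof (cases "K \<inter> S = {}")
      case True
      then show ?thesis using K by auto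
    next
      case False
      then obtain v where v: "v \<in> K" "v \<in> S" by auto
      then have "K - {v} \<in> ?\<B> v" using K by auto
      moreover have "K = insert v (K - {v})" using v by auto
      ultimately show ?thesis using v by blast
    qed
  qed
  then have "card ?\<K> \<le> card (?\<A> \<union> (\<Union>v\<in>S. insert v ` ?\<B> v))"
    using fin finS by (intro card_mono) auto
  also have "\<dots> \<le> card ?\<A> + card (\<Union>v\<in>S. insert v ` ?\<B> v)" by (rule card_Un_le)
  also have "\<dots> \<le> card ?\<A> + (\<Sum>v\<in>S. card (insert v ` ?\<B> v))"
    using card_UN_le[OF finS] by (rule add_left_mono)
  also have "\<dots> \<le> card ?\<A> + (\<Sum>v\<in>S. card (?\<B> v))"
    by (intro add_left_mono sum_mono card_image_le fin)
  also have "\<dots> = ((card W - card S) choose s) + (\<Sum>v\<in>S. card (E `` {v}) choose (s - 1))"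
    using assms finS finE by (simp add: n_subsets card_Diff_subset)
  finally show ?thesis .
qed

section \<open>Convexity of the clique bound\<close>

lemma discrete_convex_le_max:
  fixes f :: "nat \<Rightarrow> nat"
  assumes convex: "\<And>j. a \<le> j \<Longrightarrow> j + 2 \<le> b \<Longrightarrow> 2 * f (j + 1) \<le> f j + f (j + 2)"
    and "a \<le> k" "k \<le> b"
  shows "f k \<le> max (f a) (f b)"
proof -
  \<comment> \<open>By convexity, a descent at one step forces a descent at every earlier step back
    to \<open>a\<close>.\<close>
  have descent: "f (Suc m) < f m \<longrightarrow> f m \<le> f a" if "a \<le> m" "m < b" for m
    using that
  proof (induction m rule: dec_induct)
    case (step m)
    then show ?case using convex[of m] by auto
  qed simp
  have "k \<le> m \<longrightarrow> f k \<le> max (f a) (f m)" if "a \<le> m" "m \<le> b" for m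
    using that
  proof (induction m rule: dec_induct)
    case base
    then show ?case using assms(2) by auto
  next
    case (step m)
    then show ?case using descent[of m] by (auto simp: le_Suc_eq)
  qed
  then show ?thesis using assms(2,3) by auto
qed

text \<open>By Pascal's rule the consecutive differences are \<open>m choose (r - 1)\<close>, which
  grow with \<open>m\<close>.\<close>

lemma binomial_convex:
  assumes "r \<ge> 1"
  shows "2 * (Suc m choose r) \<le> (m choose r) + (Suc (Suc m) choose r)"
proof -
  obtain q where q: "r = Suc q" using assms by (cases r) auto
  have "(m choose q) \<le> (Suc m choose q)" by (rule binomial_right_mono) simp
  then show ?thesis unfolding q by simp
qed

lemma binomial_product_convex:
  assumes "r \<ge> 1"
  shows "2 * ((i + 1) * (Suc m choose r))
    \<le> i * (m choose r) + (i + 2) * (Suc (Suc m) choose r)"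
proof -
  have "i * (2 * (Suc m choose r)) \<le> i * ((m choose r) + (Suc (Suc m) choose r))"
    using binomial_convex[OF assms] by (rule mult_le_mono2)
  moreover have "(Suc m choose r) \<le> (Suc (Suc m) choose r)"
    by (rule binomial_right_mono) simp
  ultimately show ?thesis by (simp add: algebra_simps)
qed

text \<open>This is the clique count for \<open>k - t\<close> chosen vertices: one has degree
  \<open>\<delta>\<close> and gives the last term, the other \<open>k - t - 1\<close> have degree at
  most \<open>k\<close>.\<close>

definition clique_bound :: "nat \<Rightarrow> nat \<Rightarrow> nat \<Rightarrow> nat \<Rightarrow> nat \<Rightarrow> nat" where
  "clique_bound n t \<delta> s k =
    ((n + t - k) choose s) + (k - t - 1) * (k choose (s - 1)) + (\<delta> choose (s - 1))"

text \<open>At \<open>k = \<delta>\<close> the separate term joins the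
  \<open>\<delta> - t - 1\<close> equal ones; \<open>t < \<delta>\<close> keeps that subtraction
  from truncating.\<close>

lemma clique_bound_min_degree:
  assumes "t < \<delta>"
  shows "clique_bound n t \<delta> s \<delta> = f0 n t \<delta> s"
proof -
  obtain d where "\<delta> - t = Suc d" using assms by (metis Suc_diff_Suc)
  then show ?thesis unfolding clique_bound_def f0_def by simp
qed

lemma clique_bound_half:
  "clique_bound n t \<delta> s ((n + t - 1) div 2) = g0 n t \<delta> s"
  unfolding clique_bound_def g0_def Let_def by simp

lemma clique_bound_le_max:
  assumes "s \<ge> 2" "t < \<delta>" "\<delta> \<le> k" "k \<le> (n + t - 1) div 2"
  shows "clique_bound n t \<delta> s k \<le> max (f0 n t \<delta> s) (g0 n t \<delta> s)"
proof -
  let ?h = "(n + t - 1) div 2"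
  have "clique_bound n t \<delta> s k \<le> max (clique_bound n t \<delta> s \<delta>) (clique_bound n t \<delta> s ?h)"
  proof (rule discrete_convex_le_max[OF _ assms(3,4)])
    fix j assume j: "\<delta> \<le> j" "j + 2 \<le> ?h"
    \<comment> \<open>The upper index of the first binomial falls as \<open>j\<close> rises, so its
      convexity is read in reverse order. The factor \<open>i\<close> rises with \<open>j\<close>,
      without truncation as \<open>t < \<delta> \<le> j\<close>.\<close>
    define m where "m = n + t - (j + 2)"
    define i where "i = j - t - 1"
    have m: "n + t - (j + 2) = m" "n + t - (j + 1) = Suc m" "n + t - j = Suc (Suc m)"
      using j unfolding m_def by linarith+
    have i: "j - t - 1 = i" "j + 1 - t - 1 = i + 1" "j + 2 - t - 1 = i + 2"
      using j assms(2) unfolding i_def by linarith+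
    have "2 * (Suc m choose s) \<le> (m choose s) + (Suc (Suc m) choose s)"
      using assms(1) by (intro binomial_convex) simp
    moreover have "2 * ((i + 1) * (Suc j choose (s - 1)))
        \<le> i * (j choose (s - 1)) + (i + 2) * (Suc (Suc j) choose (s - 1))"
      using assms(1) by (intro binomial_product_convex) simp
    ultimately show "2 * clique_bound n t \<delta> s (j + 1)
        \<le> clique_bound n t \<delta> s j + clique_bound n t \<delta> s (j + 2)"
      unfolding clique_bound_def m i by simp
  qed
  then show ?thesis using clique_bound_min_degree[OF assms(2)] clique_bound_half by simp
qed

section \<open>From linkages to indexed path covers\<close>

text \<open>Two distinct members with the same image would give it multiplicity two in
  \<open>mset_set A\<close>. Applied to \<open>hd\<close> and \<open>last\<close>, this lets paths
  be indexed by their ends.\<close>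

lemma bij_betw_set_mset:
  assumes "image_mset f M = mset_set A" "finite A"
  shows "bij_betw f (set_mset M) A"
  unfolding bij_betw_def
proof
  show "f ` set_mset M = A" using assms by (metis finite_set_mset_mset_set set_image_mset)
  show "inj_on f (set_mset M)"
  proof (rule inj_onI, rule ccontr)
    fix p q assume pq: "p \<in># M" "q \<in># M" "f p = f q" "p \<noteq> q"
    then obtain N where "M = add_mset p (add_mset q N)"
      by (metis insert_noteq_member mset_add)
    then have "count (mset_set A) (f p) \<ge> 2" using pq(3) assms(1)[symmetric] by simp
    then show False by (simp add: count_mset_set' split: if_splits)
  qed
qed

lemma linkage_mem_unique:
  assumes "linkage E W U T M" "finite W" "x \<in> W"
  shows "\<exists>!p. p \<in># M \<and> x \<in> set p"
proof (rule ex_ex1I)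
  have W: "(\<Sum>p\<in>#M. mset p) = mset_set W" using assms(1) unfolding linkage_def by blast
  have "x \<in># (\<Sum>p\<in>#M. mset p)" unfolding W using assms(2,3) by simp
  then show "\<exists>p. p \<in># M \<and> x \<in> set p" by auto
  fix p q assume pq: "p \<in># M \<and> x \<in> set p" "q \<in># M \<and> x \<in> set q"
  show "p = q"
  proof (rule ccontr)
    assume "p \<noteq> q"
    then obtain N where "M = add_mset p (add_mset q N)"
      using pq by (metis insert_noteq_member mset_add)
    then have "count (mset_set W) x \<ge> count (mset p) x + count (mset q) x"
      unfolding W[symmetric] by simp
    moreover have "count (mset p) x \<ge> 1" "count (mset q) x \<ge> 1"
      using pq by (simp_all add: Suc_le_eq)
    moreover have "count (mset_set W) x \<le> 1" by (simp add: count_mset_set')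
    ultimately show False by linarith
  qed
qed

lemma linkage_distinct:
  assumes "linkage E W U T M" "p \<in># M"
  shows "distinct p"
proof -
  obtain N where "M = add_mset p N" using assms(2) by (metis mset_add)
  then have "mset_set W = mset p + (\<Sum>q\<in>#N. mset q)"
    using assms(1) unfolding linkage_def by simp
  then have "count (mset p) x \<le> count (mset_set W) x" for x by simp
  then have le: "count (mset p) x \<le> 1" for x
    by (rule order_trans) (simp add: count_mset_set')
  have "count (mset p) x = (if x \<in> set p then 1 else 0)" for x
  proof (cases "x \<in> set p")
    case True
    then have "count (mset p) x \<ge> 1" by (simp add: Suc_le_eq)
    with le[of x] have "count (mset p) x = 1" by (rule antisym)
    then show ?thesis using True by (simp only: if_True)
  qed (simp add: count_list_0_iff)
  then show ?thesis unfolding distinct_count_atmost_1 by blast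
qed

lemma vwalk_if_successively:
  assumes "wf_digraph G" "p \<noteq> []" "set p \<subseteq> verts G"
    and "successively (\<lambda>a b. (a, b) \<in> arcs_ends G) p"
  shows "vwalk p G"
proof -
  have "set (vwalk_arcs p) \<subseteq> arcs_ends G"
    using assms(4) by (induction p rule: vwalk_arcs.induct) auto
  then show ?thesis using assms(2,3) by (simp add: vwalk_def)
qed

lemma linkage_imp_path_cover:
  fixes G :: "('a, 'b) pre_digraph" and u v :: "nat \<Rightarrow> 'a"
  assumes "graph G"
    and inj: "inj_on u {1..t}" "inj_on v {1..t}"
    and L: "linkage (arcs_ends G) (verts G) (u ` {1..t}) (v ` {1..t}) M"
  shows "\<exists>\<tau> P. \<tau> permutes {1..t} \<and>
    (\<forall>i\<in>{1..t}. joins G (P i) (u i) (v (\<tau> i))) \<and>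
    (\<forall>x\<in>verts G. \<exists>!i. i \<in> {1..t} \<and> x \<in> set (P i))"
proof -
  interpret graph G by fact
  let ?I = "{1..t}"
  have hd: "bij_betw hd (set_mset M) (u ` ?I)" and last: "bij_betw last (set_mset M) (v ` ?I)"
    using L unfolding linkage_def by (auto intro: bij_betw_set_mset)
  \<comment> \<open>\<open>P i\<close> is the path starting at \<open>u i\<close>;
    \<open>\<sigma>\<close> below then reads off the index of its end among the
    \<open>v j\<close>.\<close>
  define P where "P = inv_into (set_mset M) hd \<circ> u"
  have P: "bij_betw P ?I (set_mset M)"
    unfolding P_def using bij_betw_trans inj_on_imp_bij_betw[OF inj(1)] bij_betw_inv_into[OF hd]
    by blast
  have hdP: "hd (P i) = u i" if "i \<in> ?I" for i
    unfolding P_def using that bij_betw_inv_into_right[OF hd] by simp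
  define \<sigma> where "\<sigma> = inv_into ?I v \<circ> (last \<circ> P)"
  have "bij_betw \<sigma> ?I ?I"
    unfolding \<sigma>_def
    using bij_betw_trans[OF bij_betw_trans[OF P last] bij_betw_inv_into[OF inj_on_imp_bij_betw[OF inj(2)]]] .
  \<comment> \<open>\<open>permutes\<close> demands the identity outside the index set, where
    \<open>\<sigma>\<close> is uncontrolled.\<close>
  define \<tau> where "\<tau> i = (if i \<in> ?I then \<sigma> i else i)" for i
  have "bij_betw \<tau> ?I ?I"
    using \<open>bij_betw \<sigma> ?I ?I\<close> by (rule bij_betw_cong[THEN iffD1, rotated]) (simp add: \<tau>_def)
  then have perm: "\<tau> permutes ?I" by (rule bij_imp_permutes) (auto simp: \<tau>_def)
  have PM: "P i \<in># M" if "i \<in> ?I" for i using P that by (rule bij_betwE[rule_format])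
  have lastP: "last (P i) = v (\<tau> i)" if "i \<in> ?I" for i
  proof -
    have "last (P i) \<in> v ` ?I" using last PM[OF that] by (auto dest: bij_betwE)
    then show ?thesis using that f_inv_into_f[of "last (P i)" v ?I] by (simp add: \<tau>_def \<sigma>_def)
  qed
  have vert: "set p \<subseteq> verts G" if "p \<in># M" for p
  proof
    fix x assume "x \<in> set p"
    then have "x \<in># (\<Sum>p\<in>#M. mset p)" using that by auto
    then have "x \<in># mset_set (verts G)" using L unfolding linkage_def by simp
    then show "x \<in> verts G" by simp
  qed
  have "joins G (P i) (u i) (v (\<tau> i))" if i: "i \<in> ?I" for i
  proof -
    have "P i \<noteq> []" "successively (\<lambda>a b. (a, b) \<in> arcs_ends G) (P i)"
      using L PM[OF i] unfolding linkage_def by blast+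
    then have "vwalk (P i) G" using vert[OF PM[OF i]] wf_digraph_axioms
      by (intro vwalk_if_successively)
    then show ?thesis
      unfolding joins_def vpath_def
      using linkage_distinct[OF L PM[OF i]] hdP[OF i] lastP[OF i] by simp
  qed
  moreover have "\<exists>!i. i \<in> ?I \<and> x \<in> set (P i)" if x: "x \<in> verts G" for x
  proof -
    obtain p where p: "p \<in># M" "x \<in> set p" "\<And>q. q \<in># M \<Longrightarrow> x \<in> set q \<Longrightarrow> q = p"
      using linkage_mem_unique[OF L finite_verts x] by blast
    have "p \<in> P ` ?I" using P p(1) by (simp only: bij_betw_def)
    then obtain i where i: "i \<in> ?I" "P i = p" by blast
    show ?thesis
    proof (rule ex1I[of _ i])
      fix j assume "j \<in> ?I \<and> x \<in> set (P j)"
      then have "j \<in> ?I" "P j = P i" using p(3) PM i(2) by auto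
      then show "j = i" using i(1) by (intro inj_onD[OF bij_betw_imp_inj_on[OF P]])
    qed (use i p(2) in simp)
  qed
  ultimately show ?thesis using perm by blast
qed

text \<open>Without parallel arcs, an arc leaving \<open>v\<close> is determined by its
  head.\<close>

lemma (in nomulti_digraph) out_degree_eq_card_arcs_ends:
  "out_degree G v = card (arcs_ends G `` {v})"
proof -
  have "arcs_ends G `` {v} = head G ` out_arcs G v"
    by (auto simp: arcs_ends_conv out_arcs_def)
  moreover have "inj_on (head G) (out_arcs G v)"
    using no_multi_arcs by (auto simp: inj_on_def out_arcs_def arc_to_ends_def)
  ultimately show ?thesis by (simp add: out_degree_def card_image)
qed

section \<open>Combining the degree condition with the clique count\<close>

theorem theorem2p9:
  fixes n s t \<delta> :: nat
    and G :: "('a, 'b) pre_digraph"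
  assumes "s \<ge> 2"
    and "4 \<le> 2 * t" and "2 * t \<le> \<delta>" and "\<delta> \<le> (n + t - 1) div 2"
    and "graph G" and "connected G"
    and "card (verts G) = n"
    and "min_degree G = \<delta>"
    and "num_cliques s G > max (f0 n t \<delta> s) (g0 n t \<delta> s)"
  shows "disjoint_path_coverable t G"
  unfolding disjoint_path_coverable_def
proof (intro allI impI, elim conjE)
  interpret graph G by fact
  fix u v :: "nat \<Rightarrow> 'a"
  assume inj: "inj_on u {1..t}" "inj_on v {1..t}"
    and sub: "u ` {1..t} \<subseteq> verts G" "v ` {1..t} \<subseteq> verts G"
    and disj: "u ` {1..t} \<inter> v ` {1..t} = {}"
  let ?E = "arcs_ends G" and ?W = "verts G"
  let ?deg = "\<lambda>v. card (?E `` {v})"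
  have EW: "?E \<subseteq> ?W \<times> ?W" by (auto simp: arcs_ends_conv)
  have "sym ?E" using sym_arcs by (simp add: symmetric_def)
  have "irrefl ?E" using no_loops by (auto simp: irrefl_def arcs_ends_conv)
  have card: "card (u ` {1..t}) = t" "card (v ` {1..t}) = t"
    using inj by (simp_all add: card_image)
  have "?W \<noteq> {}" using assms(2) sub by auto
  have deg: "\<delta> = Min (?deg ` ?W)"
    using assms(8) by (simp add: min_degree_def out_degree_eq_card_arcs_ends)
  have min: "\<delta> \<le> ?deg w" if "w \<in> ?W" for w unfolding deg using that by simp
  have "\<delta> \<in> ?deg ` ?W" unfolding deg using \<open>?W \<noteq> {}\<close> by (intro Min_in) auto
  then obtain w where w: "w \<in> ?W" "?deg w = \<delta>" by auto
  show "\<exists>\<tau> P. \<tau> permutes {1..t} \<and>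
      (\<forall>i\<in>{1..t}. joins G (P i) (u i) (v (\<tau> i))) \<and>
      (\<forall>x\<in>?W. \<exists>!i. i \<in> {1..t} \<and> x \<in> set (P i))"
  proof (rule ccontr)
    assume "\<not> ?thesis"
    then have none: "\<not> linkage ?E ?W (u ` {1..t}) (v ` {1..t}) M" for M
      using linkage_imp_path_cover[OF \<open>graph G\<close> inj] by blast
    have "card (u ` {1..t}) = card (v ` {1..t})" "u ` {1..t} \<noteq> {}"
      using card assms(2) by auto
    from nonlinkable_low_degrees[OF finite_verts EW \<open>sym ?E\<close> \<open>irrefl ?E\<close> sub disj this none]
    obtain k x where "x \<in> ?W" "?deg x \<le> k" "2 * k < card ?W + card (u ` {1..t})"
      "k \<le> card {w \<in> ?W. ?deg w \<le> k} + card (u ` {1..t})" .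
    then have k: "x \<in> ?W" "?deg x \<le> k" "2 * k < n + t" "k \<le> card {w \<in> ?W. ?deg w \<le> k} + t"
      by (simp_all only: card assms(7))
    \<comment> \<open>The vertex \<open>x\<close> serves only to place \<open>k\<close> above the
      minimum degree.\<close>
    have "\<delta> \<le> k" using min[OF k(1)] k(2) by linarith
    have "k \<le> (n + t - 1) div 2" using k(3) by linarith
    have "t < \<delta>" using assms(2,3) by linarith
    let ?L = "{w \<in> ?W. ?deg w \<le> k}"
    have "w \<in> ?L" using w \<open>\<delta> \<le> k\<close> by simp
    \<comment> \<open>The vertex \<open>w\<close> of degree \<open>\<delta>\<close> is set aside, so
      that it certainly belongs to the chosen set and contributes the smaller binomial.\<close>
    then have "k - t - 1 \<le> card (?L - {w})" using k(4) by simp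
    then obtain S' where S': "S' \<subseteq> ?L - {w}" "card S' = k - t - 1" "finite S'"
      by (rule obtain_subset_with_card_n)
    let ?S = "insert w S'"
    have "w \<notin> S'" using S'(1) by blast
    then have cS: "card ?S = k - t" using S' \<open>t < \<delta>\<close> \<open>\<delta> \<le> k\<close> by simp
    have "num_cliques s G \<le> ((card ?W - card ?S) choose s) + (\<Sum>v\<in>?S. ?deg v choose (s - 1))"
      unfolding num_cliques_def cliques_def
      by (rule card_cliques_le[OF finite_verts EW]) (use S'(1) w assms(1) in auto)
    also have "(\<Sum>v\<in>?S. ?deg v choose (s - 1))
        = (\<delta> choose (s - 1)) + (\<Sum>v\<in>S'. ?deg v choose (s - 1))"
      using S'(3) \<open>w \<notin> S'\<close> w(2) by simp
    also have "(\<Sum>v\<in>S'. ?deg v choose (s - 1)) \<le> (\<Sum>v\<in>S'. k choose (s - 1))"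
      by (intro sum_mono binomial_right_mono) (use S'(1) in auto)
    also have "card ?W - card ?S = n + t - k"
      using cS assms(7) \<open>t < \<delta>\<close> \<open>\<delta> \<le> k\<close> by simp
    finally have "num_cliques s G \<le> clique_bound n t \<delta> s k"
      using S'(2) by (simp add: clique_bound_def)
    also have "\<dots> \<le> max (f0 n t \<delta> s) (g0 n t \<delta> s)"
      by (rule clique_bound_le_max) fact+
    finally show False using assms(9) by simp
  qed
qed

end
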